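(* $\Sigma$-spaces are unique up to isomorphisms: if $\mathcal C$ is a semi-cartesian category with dependence (SCCwD), $\Gamma\in\mathcal C$, $A\in\mathscr D_{\mathcal C}(\Gamma)$, $B\in\mathscr D_{\mathcal C}(\Gamma.A)$, and $\Sigma(A,B),\Sigma'(A,B)\in\mathscr D_{\mathcal C}(\Gamma)$ are both $\Sigma$-spaces of $A$ and $B$ in $\mathcal C$, then $\Sigma(A,B)\cong\Sigma'(A,B)$ as D-objects.
   Context: A category with dependence (CwD) is a category $\mathcal C$ with: for each object $\Gamma$ a class $\mathscr D_{\mathcal C}(\Gamma)$ of D-objects over $\Gamma$; for each $\Gamma$, $A\in\mathscr D_{\mathcal C}(\Gamma)$ a class $\mathscr D_{\mathcal C}(\Gamma,A)$ of D-morphisms from $\Gamma$ to $A$; for each morphism $\phi:\Delta\to\Gamma$ functions $\_\{\phi\}:\mathscr D(\Gamma)\to\mathscr D(\Delta)$ and $\_\{\phi\}:\mathscr D(\Gamma,A)\to\mathscr D(\Delta,A\{\phi\})$ with $A\{\mathrm{id}\}=A$, $a\{\mathrm{id}\}=a$, $A\{\phi\circ\varphi\}=A\{\phi\}\{\varphi\}$, $a\{\phi\circ\varphi\}=a\{\phi\}\{\varphi\}$. A semi-$\Sigma$-space of $\Gamma$ and $A\in\mathscr D(\Gamma)$ is an object $\Gamma.A$ with $\pi_1:\Gamma.A\to\Gamma$ and $\pi_2\in\mathscr D(\Gamma.A,A\{\pi_1\})$ such that for all $\phi:\Delta\to\Gamma$ and $g\in\mathscr D(\Delta,A\{\phi\})$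 there is a unique $\langle\phi,g\rangle:\Delta\to\Gamma.A$ with $\pi_1\circ\langle\phi,g\rangle=\phi$ and $\pi_2\{\langle\phi,g\rangle\}=g$. An SCCwD is a CwD that has a terminal object and a semi-$\Sigma$-space of every $\Gamma$ and $A$. The category $\mathcal C_{\mathscr D}$ of D-objects: objects are pairs $(\Gamma,C)$ with $C\in\mathscr D(\Gamma)$; morphisms $(\Delta,D)\to(\Gamma,C)$ are pairs $(\phi,f)$ with $\phi:\Delta\to\Gamma$, $f\in\mathscr D(\Delta.D,C\{\phi\circ\pi_1\})$; composition $(\psi,g)\circ(\phi,f)=(\psi\circ\phi,g\{\langle\phi\circ\pi_1,f\rangle\})$; identities $(\mathrm{id}_\Gamma,\pi_2)$. D-objects $A\in\mathscr D(\Gamma)$, $B\in\mathscr D(\Delta)$ are isomorphic, $A\cong B$, if $(\Gamma,A)\cong(\Delta,B)$ in $\mathcal C_{\mathscr D}$. A $\Sigma$-space of $A\in\mathscr D(\Gamma)$ and $B\in\mathscr D(\Gamma.A)$ is a D-object $\Sigma(A,B)\in\mathscr D(\Gamma)$ with D-morphisms $\varpi_1\in\mathscr D(\Gamma.\Sigma(A,B),A\{\pi_1\})$ and $\varpi_2\in\mathscr D(\Gamma.\Sigma(A,B),B\{\langle\pi_1,\varpi_1\rangle\})$ such that for any $\phi:\Delta\to\Gamma$, $g\in\mathscr D(\Delta,A\{\phi\})$, $h\in\mathscr D(\Delta,B\{\langle\phi,g\rangle\})$ there exists a unique $[g,h]\in\mathscr D(\Delta,\Sigma(A,B)\{\phi\})$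 with $\varpi_1\{\langle\phi,[g,h]\rangle\}=g$ and $\varpi_2\{\langle\phi,[g,h]\rangle\}=h$. *)

theory Defs
  imports Main
begin

record ('o, 'm) category =
  objs :: "'o set"
  arrs :: "'m set"
  src :: "'m \<Rightarrow> 'o"
  tgt :: "'m \<Rightarrow> 'o"
  ident :: "'o \<Rightarrow> 'm"
  cmp :: "'m \<Rightarrow> 'm \<Rightarrow> 'm"  (infixl \<open>\<cdot>\<index>\<close> 70)

definition hom :: "('o, 'm, 'z) category_scheme \<Rightarrow> 'o \<Rightarrow> 'o \<Rightarrow> 'm set" where
  "hom C X Y = {f \<in> arrs C. src C f = X \<and> tgt C f = Y}"

(* The value of g \<cdot> f is constrained only when tgt f = src g. *)
locale category =
  fixes C :: "('o, 'm, 'z) category_scheme" (structure)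
  assumes src_closed: "f \<in> arrs C \<Longrightarrow> src C f \<in> objs C"
    and tgt_closed: "f \<in> arrs C \<Longrightarrow> tgt C f \<in> objs C"
    and ident_hom: "X \<in> objs C \<Longrightarrow> ident C X \<in> hom C X X"
    and cmp_hom: "f \<in> hom C X Y \<Longrightarrow> g \<in> hom C Y Z \<Longrightarrow> g \<cdot> f \<in> hom C X Z"
    and cmp_ident_left: "f \<in> hom C X Y \<Longrightarrow> ident C Y \<cdot> f = f"
    and cmp_ident_right: "f \<in> hom C X Y \<Longrightarrow> f \<cdot> ident C X = f"
    and cmp_assoc: "f \<in> hom C W X \<Longrightarrow> g \<in> hom C X Y \<Longrightarrow> h \<in> hom C Y Z \<Longrightarrow>
      h \<cdot> (g \<cdot> f) = (h \<cdot> g) \<cdot> f"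

definition terminal_object :: "('o, 'm, 'z) category_scheme \<Rightarrow> 'o \<Rightarrow> bool" where
  "terminal_object C T \<longleftrightarrow> T \<in> objs C \<and> (\<forall>X\<in>objs C. \<exists>!f. f \<in> hom C X T)"

definition isomorphic_objects :: "('o, 'm, 'z) category_scheme \<Rightarrow> 'o \<Rightarrow> 'o \<Rightarrow> bool" where
  "isomorphic_objects C X Y \<longleftrightarrow>
    X \<in> objs C \<and> Y \<in> objs C \<and>
    (\<exists>f\<in>hom C X Y. \<exists>g\<in>hom C Y X.
      cmp C g f = ident C X \<and> cmp C f g = ident C Y)"

(* osub C A \<phi> is A{\<phi>}, for A a D-object over the target of \<phi>.
   msub C A \<phi> a is a{\<phi>}, for a a D-morphism to A.  The D-object A is an explicit
   argument because the families of D-objects and of D-morphisms are not assumed to be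
   pairwise disjoint, so a need not determine A. *)
record ('o, 'm, 'd, 'e) cwd = "('o, 'm) category" +
  dobj :: "'o \<Rightarrow> 'd set"
  dmor :: "'o \<Rightarrow> 'd \<Rightarrow> 'e set"
  osub :: "'d \<Rightarrow> 'm \<Rightarrow> 'd"
  msub :: "'d \<Rightarrow> 'm \<Rightarrow> 'e \<Rightarrow> 'e"

locale CwD = category C for C :: "('o, 'm, 'd, 'e, 'z) cwd_scheme" (structure) +
  assumes osub_closed:
      "\<phi> \<in> hom C \<Delta> \<Gamma> \<Longrightarrow> A \<in> dobj C \<Gamma> \<Longrightarrow> osub C A \<phi> \<in> dobj C \<Delta>"
    and msub_closed:
      "\<phi> \<in> hom C \<Delta> \<Gamma> \<Longrightarrow> A \<in> dobj C \<Gamma> \<Longrightarrow> a \<in> dmor C \<Gamma> A \<Longrightarrow>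
        msub C A \<phi> a \<in> dmor C \<Delta> (osub C A \<phi>)"
    and osub_ident:
      "\<Gamma> \<in> objs C \<Longrightarrow> A \<in> dobj C \<Gamma> \<Longrightarrow> osub C A (ident C \<Gamma>) = A"
    and msub_ident:
      "\<Gamma> \<in> objs C \<Longrightarrow> A \<in> dobj C \<Gamma> \<Longrightarrow> a \<in> dmor C \<Gamma> A \<Longrightarrow>
        msub C A (ident C \<Gamma>) a = a"
    and osub_cmp:
      "\<psi> \<in> hom C \<Theta> \<Delta> \<Longrightarrow> \<phi> \<in> hom C \<Delta> \<Gamma> \<Longrightarrow> A \<in> dobj C \<Gamma> \<Longrightarrow>
        osub C A (\<phi> \<cdot> \<psi>) = osub C (osub C A \<phi>) \<psi>"
    and msub_cmp:
      "\<psi> \<in> hom C \<Theta> \<Delta> \<Longrightarrow> \<phi> \<in> hom C \<Delta> \<Gamma> \<Longrightarrow> A \<in> dobj C \<Gamma> \<Longrightarrow> a \<in> dmor C \<Gamma> A \<Longrightarrow>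
        msub C A (\<phi> \<cdot> \<psi>) a = msub C (osub C A \<phi>) \<psi> (msub C A \<phi> a)"

definition is_semi_Sigma_space ::
  "('o, 'm, 'd, 'e, 'z) cwd_scheme \<Rightarrow> 'o \<Rightarrow> 'd \<Rightarrow> 'o \<Rightarrow> 'm \<Rightarrow> 'e \<Rightarrow> bool" where
  "is_semi_Sigma_space C \<Gamma> A P p q \<longleftrightarrow>
    P \<in> objs C \<and> p \<in> hom C P \<Gamma> \<and> q \<in> dmor C P (osub C A p) \<and>
    (\<forall>\<Delta>\<in>objs C. \<forall>\<phi>\<in>hom C \<Delta> \<Gamma>. \<forall>g\<in>dmor C \<Delta> (osub C A \<phi>).
      \<exists>!u. u \<in> hom C \<Delta> P \<and> cmp C p u = \<phi> \<and> msub C (osub C A p) u q = g)"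

(* A choice of semi-Sigma-spaces is carried as data, so that \<Gamma>.A denotes an object. *)
record ('o, 'm, 'd, 'e) sccwd = "('o, 'm, 'd, 'e) cwd" +
  ext :: "'o \<Rightarrow> 'd \<Rightarrow> 'o"
  pi1 :: "'o \<Rightarrow> 'd \<Rightarrow> 'm"
  pi2 :: "'o \<Rightarrow> 'd \<Rightarrow> 'e"

locale SCCwD = CwD C for C :: "('o, 'm, 'd, 'e, 'z) sccwd_scheme" (structure) +
  assumes has_terminal: "\<exists>T. terminal_object C T"
    and has_semi_Sigma: "\<Gamma> \<in> objs C \<Longrightarrow> A \<in> dobj C \<Gamma> \<Longrightarrow>
      is_semi_Sigma_space C \<Gamma> A (ext C \<Gamma> A) (pi1 C \<Gamma> A) (pi2 C \<Gamma> A)"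

(* \<langle>\<phi>, g\<rangle> : \<Delta> \<rightarrow> \<Gamma>.A, where \<Delta> is the source of \<phi>. *)
definition dpair ::
  "('o, 'm, 'd, 'e, 'z) sccwd_scheme \<Rightarrow> 'o \<Rightarrow> 'd \<Rightarrow> 'm \<Rightarrow> 'e \<Rightarrow> 'm" where
  "dpair C \<Gamma> A \<phi> g =
    (THE u. u \<in> hom C (src C \<phi>) (ext C \<Gamma> A) \<and> cmp C (pi1 C \<Gamma> A) u = \<phi> \<and>
      msub C (osub C A (pi1 C \<Gamma> A)) u (pi2 C \<Gamma> A) = g)"

(* A morphism (base, fib) tagged with its source and target pairs. *)
datatype ('o, 'm, 'd, 'e) darr =
  DArr (dsrc: "'o \<times> 'd") (dtgt: "'o \<times> 'd") (base: 'm) (fib: 'e)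

definition dobj_hom ::
  "('o, 'm, 'd, 'e, 'z) sccwd_scheme \<Rightarrow> 'o \<times> 'd \<Rightarrow> 'o \<times> 'd \<Rightarrow> ('m \<times> 'e) set" where
  "dobj_hom C = (\<lambda>(\<Delta>, D) (\<Gamma>, E). {(\<phi>, f).
    \<phi> \<in> hom C \<Delta> \<Gamma> \<and> f \<in> dmor C (ext C \<Delta> D) (osub C E (cmp C \<phi> (pi1 C \<Delta> D)))})"

(* For (\<phi>, f) : (\<Delta>, D) \<rightarrow> (\<Gamma>, E) and (\<psi>, g) : (\<Gamma>, E) \<rightarrow> (\<Theta>, F), the D-morphism g
   goes to the D-object F{\<psi> \<circ> pi1} over \<Gamma>.E. *)
fun dobj_cmp ::
  "('o, 'm, 'd, 'e, 'z) sccwd_scheme \<Rightarrow> ('o, 'm, 'd, 'e) darr \<Rightarrow> ('o, 'm, 'd, 'e) darr \<Rightarrow>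
    ('o, 'm, 'd, 'e) darr" where
  "dobj_cmp C (DArr (\<Gamma>, E) (\<Theta>, F) \<psi> g) (DArr (\<Delta>, D) Y \<phi> f) =
    DArr (\<Delta>, D) (\<Theta>, F) (cmp C \<psi> \<phi>)
      (msub C (osub C F (cmp C \<psi> (pi1 C \<Gamma> E)))
        (dpair C \<Gamma> E (cmp C \<phi> (pi1 C \<Delta> D)) f) g)"

definition dobj_category ::
  "('o, 'm, 'd, 'e, 'z) sccwd_scheme \<Rightarrow> ('o \<times> 'd, ('o, 'm, 'd, 'e) darr) category" where
  "dobj_category C =
    \<lparr>objs = (SIGMA \<Gamma>:objs C. dobj C \<Gamma>),
     arrs = {DArr X Y \<phi> f |X Y \<phi> f.
       X \<in> (SIGMA \<Gamma>:objs C. dobj C \<Gamma>) \<and> Y \<in> (SIGMA \<Gamma>:objs C. dobj C \<Gamma>) \<and>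
       (\<phi>, f) \<in> dobj_hom C X Y},
     src = dsrc,
     tgt = dtgt,
     ident = (\<lambda>(\<Gamma>, A). DArr (\<Gamma>, A) (\<Gamma>, A) (ident C \<Gamma>) (pi2 C \<Gamma> A)),
     cmp = dobj_cmp C\<rparr>"

definition dobj_iso ::
  "('o, 'm, 'd, 'e, 'z) sccwd_scheme \<Rightarrow> 'o \<Rightarrow> 'd \<Rightarrow> 'o \<Rightarrow> 'd \<Rightarrow> bool" where
  "dobj_iso C \<Gamma> A \<Delta> B \<longleftrightarrow> isomorphic_objects (dobj_category C) (\<Gamma>, A) (\<Delta>, B)"

definition is_Sigma_space ::
  "('o, 'm, 'd, 'e, 'z) sccwd_scheme \<Rightarrow> 'o \<Rightarrow> 'd \<Rightarrow> 'd \<Rightarrow> 'd \<Rightarrow> 'e \<Rightarrow> 'e \<Rightarrow> bool" where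
  "is_Sigma_space C \<Gamma> A B S w1 w2 \<longleftrightarrow>
    S \<in> dobj C \<Gamma> \<and>
    w1 \<in> dmor C (ext C \<Gamma> S) (osub C A (pi1 C \<Gamma> S)) \<and>
    w2 \<in> dmor C (ext C \<Gamma> S) (osub C B (dpair C \<Gamma> A (pi1 C \<Gamma> S) w1)) \<and>
    (\<forall>\<Delta>\<in>objs C. \<forall>\<phi>\<in>hom C \<Delta> \<Gamma>. \<forall>g\<in>dmor C \<Delta> (osub C A \<phi>).
      \<forall>h\<in>dmor C \<Delta> (osub C B (dpair C \<Gamma> A \<phi> g)).
      \<exists>!k. k \<in> dmor C \<Delta> (osub C S \<phi>) \<and>
        msub C (osub C A (pi1 C \<Gamma> S)) (dpair C \<Gamma> S \<phi> k) w1 = g \<and>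
        msub C (osub C B (dpair C \<Gamma> A (pi1 C \<Gamma> S) w1)) (dpair C \<Gamma> S \<phi> k) w2 = h)"

end

(* Pairing the projections of one Sigma-space through the universal property of the other gives
   D-morphisms in both directions over the identity of the base.  Their composite and pi2 both
   solve the universal problem posed by (w1, w2) over pi1, so they are equal. *)
theory Submission
  imports Defs
begin

context category
begin

lemma hom_objs:
  assumes "f \<in> hom C X Y"
  shows "X \<in> objs C" "Y \<in> objs C"
  using assms src_closed tgt_closed by (auto simp: hom_def)

end

context SCCwD
begin

lemma pi1_hom: "\<Gamma> \<in> objs C \<Longrightarrow> A \<in> dobj C \<Gamma> \<Longrightarrow> pi1 C \<Gamma> A \<in> hom C (ext C \<Gamma> A) \<Gamma>"
  using has_semi_Sigma by (auto simp: is_semi_Sigma_space_def)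

lemma pi2_dmor:
  "\<Gamma> \<in> objs C \<Longrightarrow> A \<in> dobj C \<Gamma> \<Longrightarrow> pi2 C \<Gamma> A \<in> dmor C (ext C \<Gamma> A) (osub C A (pi1 C \<Gamma> A))"
  using has_semi_Sigma by (auto simp: is_semi_Sigma_space_def)

lemma ex1_dpair:
  assumes "A \<in> dobj C \<Gamma>" "\<phi> \<in> hom C \<Delta> \<Gamma>" "g \<in> dmor C \<Delta> (osub C A \<phi>)"
  shows "\<exists>!u. u \<in> hom C \<Delta> (ext C \<Gamma> A) \<and> pi1 C \<Gamma> A \<cdot> u = \<phi> \<and>
    msub C (osub C A (pi1 C \<Gamma> A)) u (pi2 C \<Gamma> A) = g"
  using has_semi_Sigma[OF hom_objs(2)[OF assms(2)] assms(1)] hom_objs(1)[OF assms(2)] assms(2,3)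
  unfolding is_semi_Sigma_space_def by blast

lemma
  assumes "A \<in> dobj C \<Gamma>" "\<phi> \<in> hom C \<Delta> \<Gamma>" "g \<in> dmor C \<Delta> (osub C A \<phi>)"
  shows dpair_hom: "dpair C \<Gamma> A \<phi> g \<in> hom C \<Delta> (ext C \<Gamma> A)"
    and pi1_dpair: "pi1 C \<Gamma> A \<cdot> dpair C \<Gamma> A \<phi> g = \<phi>"
    and pi2_dpair: "msub C (osub C A (pi1 C \<Gamma> A)) (dpair C \<Gamma> A \<phi> g) (pi2 C \<Gamma> A) = g"
proof -
  \<comment> \<open>The description inside \<open>dpair\<close> reads the domain off as
    \<open>src C \<phi>\<close>; identifying it with \<open>\<Delta>\<close> matches it with the
    uniqueness statement.\<close>
  have "src C \<phi> = \<Delta>"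
    using assms(2) by (simp add: hom_def)
  then have "dpair C \<Gamma> A \<phi> g \<in> hom C \<Delta> (ext C \<Gamma> A) \<and> pi1 C \<Gamma> A \<cdot> dpair C \<Gamma> A \<phi> g = \<phi> \<and>
    msub C (osub C A (pi1 C \<Gamma> A)) (dpair C \<Gamma> A \<phi> g) (pi2 C \<Gamma> A) = g"
    using theI'[OF ex1_dpair[OF assms]] by (simp add: dpair_def)
  then show "dpair C \<Gamma> A \<phi> g \<in> hom C \<Delta> (ext C \<Gamma> A)" "pi1 C \<Gamma> A \<cdot> dpair C \<Gamma> A \<phi> g = \<phi>"
    "msub C (osub C A (pi1 C \<Gamma> A)) (dpair C \<Gamma> A \<phi> g) (pi2 C \<Gamma> A) = g"
    by auto
qed

text \<open>Uniqueness half of the universal property, in the form used to recognise a given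
  morphism as a pairing.\<close>

lemma dpair_eqI:
  assumes "A \<in> dobj C \<Gamma>" "\<phi> \<in> hom C \<Delta> \<Gamma>" "g \<in> dmor C \<Delta> (osub C A \<phi>)"
    and "u \<in> hom C \<Delta> (ext C \<Gamma> A)" "pi1 C \<Gamma> A \<cdot> u = \<phi>"
    and "msub C (osub C A (pi1 C \<Gamma> A)) u (pi2 C \<Gamma> A) = g"
  shows "dpair C \<Gamma> A \<phi> g = u"
  using ex1_dpair[OF assms(1-3)] dpair_hom[OF assms(1-3)] pi1_dpair[OF assms(1-3)]
    pi2_dpair[OF assms(1-3)] assms(4-6) by blast

text \<open>The identity of \<Gamma>.A solves the universal problem posed by its own
  projections.\<close>

lemma dpair_pi:
  assumes "\<Gamma> \<in> objs C" "A \<in> dobj C \<Gamma>"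
  shows "dpair C \<Gamma> A (pi1 C \<Gamma> A) (pi2 C \<Gamma> A) = ident C (ext C \<Gamma> A)"
proof (rule dpair_eqI[OF assms(2) pi1_hom[OF assms] pi2_dmor[OF assms]])
  have E: "ext C \<Gamma> A \<in> objs C"
    using hom_objs(1)[OF pi1_hom[OF assms]] .
  show "ident C (ext C \<Gamma> A) \<in> hom C (ext C \<Gamma> A) (ext C \<Gamma> A)"
    by (rule ident_hom[OF E])
  show "pi1 C \<Gamma> A \<cdot> ident C (ext C \<Gamma> A) = pi1 C \<Gamma> A"
    by (rule cmp_ident_right[OF pi1_hom[OF assms]])
  show "msub C (osub C A (pi1 C \<Gamma> A)) (ident C (ext C \<Gamma> A)) (pi2 C \<Gamma> A) = pi2 C \<Gamma> A"
    by (rule msub_ident[OF E osub_closed[OF pi1_hom[OF assms] assms(2)] pi2_dmor[OF assms]])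
qed

text \<open>Naturality of pairing in its domain: precomposing with \<open>\<theta>\<close> keeps
  both projection equations, by associativity for \<open>pi1\<close> and functoriality of
  substitution for \<open>pi2\<close>.\<close>

lemma dpair_cmp:
  assumes A: "A \<in> dobj C \<Gamma>" and \<phi>: "\<phi> \<in> hom C \<Delta> \<Gamma>" and g: "g \<in> dmor C \<Delta> (osub C A \<phi>)"
    and \<theta>: "\<theta> \<in> hom C \<Theta> \<Delta>"
  shows "dpair C \<Gamma> A (\<phi> \<cdot> \<theta>) (msub C (osub C A \<phi>) \<theta> g) = dpair C \<Gamma> A \<phi> g \<cdot> \<theta>"
proof (rule dpair_eqI[OF A cmp_hom[OF \<theta> \<phi>]])
  have \<Gamma>: "\<Gamma> \<in> objs C"
    using hom_objs(2)[OF \<phi>] .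
  note u = dpair_hom[OF A \<phi> g] and p = pi1_hom[OF \<Gamma> A]
  \<comment> \<open>Substitution yields a D-morphism to A{\<phi>}{\<theta>}; functoriality turns
    this into the type that the pairing over \<open>\<phi> \<cdot> \<theta>\<close> expects.\<close>
  show "msub C (osub C A \<phi>) \<theta> g \<in> dmor C \<Theta> (osub C A (\<phi> \<cdot> \<theta>))"
    using msub_closed[OF \<theta> osub_closed[OF \<phi> A] g] osub_cmp[OF \<theta> \<phi> A] by simp
  show "dpair C \<Gamma> A \<phi> g \<cdot> \<theta> \<in> hom C \<Theta> (ext C \<Gamma> A)"
    by (rule cmp_hom[OF \<theta> u])
  show "pi1 C \<Gamma> A \<cdot> (dpair C \<Gamma> A \<phi> g \<cdot> \<theta>) = \<phi> \<cdot> \<theta>"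
    using cmp_assoc[OF \<theta> u p] pi1_dpair[OF A \<phi> g] by simp
  show "msub C (osub C A (pi1 C \<Gamma> A)) (dpair C \<Gamma> A \<phi> g \<cdot> \<theta>) (pi2 C \<Gamma> A) =
      msub C (osub C A \<phi>) \<theta> g"
    using msub_cmp[OF \<theta> u osub_closed[OF p A] pi2_dmor[OF \<Gamma> A]] pi2_dpair[OF A \<phi> g]
      osub_cmp[OF u p A] pi1_dpair[OF A \<phi> g] by simp
qed

lemma Sigma_space_dobj: "is_Sigma_space C \<Gamma> A B S w1 w2 \<Longrightarrow> S \<in> dobj C \<Gamma>"
  by (simp add: is_Sigma_space_def)

lemma Sigma_space_proj1:
  "is_Sigma_space C \<Gamma> A B S w1 w2 \<Longrightarrow> w1 \<in> dmor C (ext C \<Gamma> S) (osub C A (pi1 C \<Gamma> S))"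
  by (simp add: is_Sigma_space_def)

lemma Sigma_space_proj2:
  "is_Sigma_space C \<Gamma> A B S w1 w2 \<Longrightarrow>
    w2 \<in> dmor C (ext C \<Gamma> S) (osub C B (dpair C \<Gamma> A (pi1 C \<Gamma> S) w1))"
  by (simp add: is_Sigma_space_def)

lemma Sigma_space_ex1:
  assumes "is_Sigma_space C \<Gamma> A B S w1 w2" "\<phi> \<in> hom C \<Delta> \<Gamma>"
    and "g \<in> dmor C \<Delta> (osub C A \<phi>)" "h \<in> dmor C \<Delta> (osub C B (dpair C \<Gamma> A \<phi> g))"
  shows "\<exists>!k. k \<in> dmor C \<Delta> (osub C S \<phi>) \<and>
    msub C (osub C A (pi1 C \<Gamma> S)) (dpair C \<Gamma> S \<phi> k) w1 = g \<and>
    msub C (osub C B (dpair C \<Gamma> A (pi1 C \<Gamma> S) w1)) (dpair C \<Gamma> S \<phi> k) w2 = h"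
  using assms hom_objs(1)[OF assms(2)] unfolding is_Sigma_space_def by blast

text \<open>\<open>k\<close> is the fibre component of a morphism from (\<Gamma>, S) to (\<Gamma>,
  S') over the identity of \<Gamma> that respects both projections. Being a predicate, it lets
  identity and composite be compared by uniqueness alone.\<close>

definition Sigma_map where
  "Sigma_map \<Gamma> A B S w1 w2 S' w1' w2' k \<longleftrightarrow>
    k \<in> dmor C (ext C \<Gamma> S) (osub C S' (pi1 C \<Gamma> S)) \<and>
    msub C (osub C A (pi1 C \<Gamma> S')) (dpair C \<Gamma> S' (pi1 C \<Gamma> S) k) w1' = w1 \<and>
    msub C (osub C B (dpair C \<Gamma> A (pi1 C \<Gamma> S') w1')) (dpair C \<Gamma> S' (pi1 C \<Gamma> S) k) w2' = w2"

text \<open>Only the universal property of \<open>S'\<close> is applied; \<open>S\<close> supplies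
  the test data, namely its two projections over \<Gamma>.S.\<close>

lemma ex1_Sigma_map:
  assumes "\<Gamma> \<in> objs C" "is_Sigma_space C \<Gamma> A B S w1 w2" "is_Sigma_space C \<Gamma> A B S' w1' w2'"
  shows "\<exists>!k. Sigma_map \<Gamma> A B S w1 w2 S' w1' w2' k"
  unfolding Sigma_map_def
  by (rule Sigma_space_ex1[OF assms(3) pi1_hom[OF assms(1) Sigma_space_dobj[OF assms(2)]]
        Sigma_space_proj1[OF assms(2)] Sigma_space_proj2[OF assms(2)]])

text \<open>\<open>pi2\<close> is the fibre of the identity of (\<Gamma>, S): by
  \<open>dpair_pi\<close> it induces the identity of \<Gamma>.S, and substitution along that fixes
  \<open>w1\<close> and \<open>w2\<close>.\<close>

lemma Sigma_map_pi2:
  assumes \<Gamma>: "\<Gamma> \<in> objs C" and A: "A \<in> dobj C \<Gamma>" and B: "B \<in> dobj C (ext C \<Gamma> A)"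
    and S: "is_Sigma_space C \<Gamma> A B S w1 w2"
  shows "Sigma_map \<Gamma> A B S w1 w2 S w1 w2 (pi2 C \<Gamma> S)"
proof -
  note SD = Sigma_space_dobj[OF S] and w1 = Sigma_space_proj1[OF S] and w2 = Sigma_space_proj2[OF S]
  note p = pi1_hom[OF \<Gamma> SD]
  note E = hom_objs(1)[OF p]
  show ?thesis
    unfolding Sigma_map_def dpair_pi[OF \<Gamma> SD]
    using pi2_dmor[OF \<Gamma> SD] msub_ident[OF E osub_closed[OF p A] w1]
      msub_ident[OF E osub_closed[OF dpair_hom[OF A p w1] B] w2] by blast
qed

text \<open>The D-morphism in the conclusion is the fibre of the composite in the category of
  D-objects. It induces the composite \<Gamma>.S \<rightarrow> \<Gamma>.S' \<rightarrow>
  \<Gamma>.S'', and substituting along the two factors in turn carries the projections of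
  \<open>S''\<close> to those of \<open>S'\<close> and then to those of \<open>S\<close>.\<close>

lemma Sigma_map_cmp:
  assumes \<Gamma>: "\<Gamma> \<in> objs C" and A: "A \<in> dobj C \<Gamma>" and B: "B \<in> dobj C (ext C \<Gamma> A)"
    and S: "is_Sigma_space C \<Gamma> A B S w1 w2" and S': "is_Sigma_space C \<Gamma> A B S' w1' w2'"
    and S'': "is_Sigma_space C \<Gamma> A B S'' w1'' w2''"
    and f: "Sigma_map \<Gamma> A B S w1 w2 S' w1' w2' f"
    and g: "Sigma_map \<Gamma> A B S' w1' w2' S'' w1'' w2'' g"
  shows "Sigma_map \<Gamma> A B S w1 w2 S'' w1'' w2''
    (msub C (osub C S'' (pi1 C \<Gamma> S')) (dpair C \<Gamma> S' (pi1 C \<Gamma> S) f) g)"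
proof -
  define p p' p'' where "p = pi1 C \<Gamma> S" and "p' = pi1 C \<Gamma> S'" and "p'' = pi1 C \<Gamma> S''"
  \<comment> \<open>\<open>u\<close> and \<open>v\<close> are the morphisms \<Gamma>.S \<rightarrow>
    \<Gamma>.S' and \<Gamma>.S' \<rightarrow> \<Gamma>.S'' over \<Gamma> induced by \<open>f\<close>
    and \<open>g\<close>.\<close>
  define u v where "u = dpair C \<Gamma> S' p f" and "v = dpair C \<Gamma> S'' p' g"
  define c where "c = msub C (osub C S'' p') u g"
  \<comment> \<open>These are the morphisms into \<Gamma>.A along which \<open>B\<close> is
    substituted in the types of \<open>w2'\<close> and \<open>w2''\<close>.\<close>
  define x' x'' where "x' = dpair C \<Gamma> A p' w1'" and "x'' = dpair C \<Gamma> A p'' w1''"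
  note defs = p_def p'_def p''_def u_def v_def c_def x'_def x''_def
  note SD = Sigma_space_dobj[OF S] Sigma_space_dobj[OF S'] Sigma_space_dobj[OF S'']
  have p: "p \<in> hom C (ext C \<Gamma> S) \<Gamma>" and p': "p' \<in> hom C (ext C \<Gamma> S') \<Gamma>"
    and p'': "p'' \<in> hom C (ext C \<Gamma> S'') \<Gamma>"
    unfolding defs using SD pi1_hom[OF \<Gamma>] by auto
  have f_dmor: "f \<in> dmor C (ext C \<Gamma> S) (osub C S' p)"
    and f1: "msub C (osub C A p') u w1' = w1" and f2: "msub C (osub C B x') u w2' = w2"
    using f unfolding Sigma_map_def defs by blast+
  have g_dmor: "g \<in> dmor C (ext C \<Gamma> S') (osub C S'' p')"
    and g1: "msub C (osub C A p'') v w1'' = w1'" and g2: "msub C (osub C B x'') v w2'' = w2'"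
    using g unfolding Sigma_map_def defs by blast+
  have w'': "w1'' \<in> dmor C (ext C \<Gamma> S'') (osub C A p'')"
    "w2'' \<in> dmor C (ext C \<Gamma> S'') (osub C B x'')"
    unfolding defs by (rule Sigma_space_proj1[OF S''] Sigma_space_proj2[OF S''])+
  have u: "u \<in> hom C (ext C \<Gamma> S) (ext C \<Gamma> S')" and pu: "p' \<cdot> u = p"
    using dpair_hom[OF SD(2) p f_dmor] pi1_dpair[OF SD(2) p f_dmor] by (simp_all add: defs)
  have v: "v \<in> hom C (ext C \<Gamma> S') (ext C \<Gamma> S'')" and pv: "p'' \<cdot> v = p'"
    using dpair_hom[OF SD(3) p' g_dmor] pi1_dpair[OF SD(3) p' g_dmor] by (simp_all add: defs)
  have x'': "x'' \<in> hom C (ext C \<Gamma> S'') (ext C \<Gamma> A)"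
    using dpair_hom[OF A p'' w''(1)] by (simp add: x''_def)
  have c: "c \<in> dmor C (ext C \<Gamma> S) (osub C S'' p)"
    using msub_closed[OF u osub_closed[OF p' SD(3)] g_dmor] osub_cmp[OF u p' SD(3)] pu
    by (simp add: c_def)
  have vu: "dpair C \<Gamma> S'' p c = v \<cdot> u"
    using dpair_cmp[OF SD(3) p' g_dmor u] by (simp add: c_def v_def pu)
  \<comment> \<open>This identifies B{x''}{v} with B{x'}, so that \<open>f2\<close> applies after
    substituting \<open>w2''\<close> along \<open>v\<close>; it rests on \<open>g1\<close>, the
    equation for the first projections.\<close>
  have xv: "x'' \<cdot> v = x'"
    using dpair_cmp[OF A p'' w''(1) v] by (simp add: x'_def x''_def pv g1)
  have "msub C (osub C A p'') (v \<cdot> u) w1'' = w1"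
    using msub_cmp[OF u v osub_closed[OF p'' A] w''(1)] osub_cmp[OF v p'' A, symmetric]
    by (simp add: pv g1 f1)
  moreover have "msub C (osub C B x'') (v \<cdot> u) w2'' = w2"
    using msub_cmp[OF u v osub_closed[OF x'' B] w''(2)] osub_cmp[OF v x'' B, symmetric]
    by (simp add: xv g2 f2)
  ultimately show ?thesis
    using c unfolding Sigma_map_def defs[symmetric] vu by blast
qed

text \<open>Both sides are \<open>Sigma_map\<close>s from \<open>S\<close> to itself, and the
  universal property of \<open>S\<close> allows only one.\<close>

lemma Sigma_map_inverse:
  assumes "\<Gamma> \<in> objs C" "A \<in> dobj C \<Gamma>" "B \<in> dobj C (ext C \<Gamma> A)"
    and "is_Sigma_space C \<Gamma> A B S w1 w2" "is_Sigma_space C \<Gamma> A B S' w1' w2'"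
    and "Sigma_map \<Gamma> A B S w1 w2 S' w1' w2' f" "Sigma_map \<Gamma> A B S' w1' w2' S w1 w2 g"
  shows "msub C (osub C S (pi1 C \<Gamma> S')) (dpair C \<Gamma> S' (pi1 C \<Gamma> S) f) g = pi2 C \<Gamma> S"
  using ex1_Sigma_map[OF assms(1,4,4)] Sigma_map_pi2[OF assms(1-4)]
    Sigma_map_cmp[OF assms(1-5,4,6,7)] by blast

text \<open>A fibre over the identity should lie in S'{id \<circ> \<open>pi1\<close>}, which the
  left unit law reduces to S'{\<open>pi1\<close>}, the type used in
  \<open>Sigma_map\<close>.\<close>

lemma vertical_hom:
  assumes "\<Gamma> \<in> objs C" "S \<in> dobj C \<Gamma>" "S' \<in> dobj C \<Gamma>"
    and "f \<in> dmor C (ext C \<Gamma> S) (osub C S' (pi1 C \<Gamma> S))"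
  shows "DArr (\<Gamma>, S) (\<Gamma>, S') (ident C \<Gamma>) f \<in> hom (dobj_category C) (\<Gamma>, S) (\<Gamma>, S')"
  using assms ident_hom cmp_ident_left[OF pi1_hom[OF assms(1,2)]]
  unfolding hom_def dobj_category_def dobj_hom_def by simp

text \<open>The unit laws remove the identities from composition over a fixed base, leaving exactly
  the fibre treated in \<open>Sigma_map_cmp\<close> and \<open>Sigma_map_inverse\<close>.\<close>

lemma vertical_cmp:
  assumes "\<Gamma> \<in> objs C" "S \<in> dobj C \<Gamma>" "S' \<in> dobj C \<Gamma>"
  shows "cmp (dobj_category C) (DArr (\<Gamma>, S') (\<Gamma>, S'') (ident C \<Gamma>) g)
      (DArr (\<Gamma>, S) (\<Gamma>, S') (ident C \<Gamma>) f) =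
    DArr (\<Gamma>, S) (\<Gamma>, S'') (ident C \<Gamma>)
      (msub C (osub C S'' (pi1 C \<Gamma> S')) (dpair C \<Gamma> S' (pi1 C \<Gamma> S) f) g)"
  using cmp_ident_left[OF ident_hom[OF assms(1)]] cmp_ident_left[OF pi1_hom[OF assms(1,2)]]
    cmp_ident_left[OF pi1_hom[OF assms(1,3)]]
  by (simp add: dobj_category_def)

lemma Sigma_space_unique:
  assumes \<Gamma>: "\<Gamma> \<in> objs C" and A: "A \<in> dobj C \<Gamma>" and B: "B \<in> dobj C (ext C \<Gamma> A)"
    and S: "is_Sigma_space C \<Gamma> A B S w1 w2" and S': "is_Sigma_space C \<Gamma> A B S' w1' w2'"
  shows "dobj_iso C \<Gamma> S \<Gamma> S'"
proof -
  obtain f where f: "Sigma_map \<Gamma> A B S w1 w2 S' w1' w2' f"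
    using ex1_Sigma_map[OF \<Gamma> S S'] by blast
  obtain g where g: "Sigma_map \<Gamma> A B S' w1' w2' S w1 w2 g"
    using ex1_Sigma_map[OF \<Gamma> S' S] by blast
  note SD = Sigma_space_dobj[OF S] and SD' = Sigma_space_dobj[OF S']
  let ?F = "DArr (\<Gamma>, S) (\<Gamma>, S') (ident C \<Gamma>) f"
  let ?G = "DArr (\<Gamma>, S') (\<Gamma>, S) (ident C \<Gamma>) g"
  have "?F \<in> hom (dobj_category C) (\<Gamma>, S) (\<Gamma>, S')"
    using f vertical_hom[OF \<Gamma> SD SD'] by (simp add: Sigma_map_def)
  moreover have "?G \<in> hom (dobj_category C) (\<Gamma>, S') (\<Gamma>, S)"
    using g vertical_hom[OF \<Gamma> SD' SD] by (simp add: Sigma_map_def)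
  moreover have "cmp (dobj_category C) ?G ?F = ident (dobj_category C) (\<Gamma>, S)"
    unfolding vertical_cmp[OF \<Gamma> SD SD'] Sigma_map_inverse[OF \<Gamma> A B S S' f g]
    by (simp add: dobj_category_def)
  \<comment> \<open>The hypotheses are symmetric in the two spaces, so the same lemma with the roles
    exchanged gives the other inverse law.\<close>
  moreover have "cmp (dobj_category C) ?F ?G = ident (dobj_category C) (\<Gamma>, S')"
    unfolding vertical_cmp[OF \<Gamma> SD' SD] Sigma_map_inverse[OF \<Gamma> A B S' S g f]
    by (simp add: dobj_category_def)
  moreover have "(\<Gamma>, S) \<in> objs (dobj_category C)" "(\<Gamma>, S') \<in> objs (dobj_category C)"
    using \<Gamma> SD SD' by (simp_all add: dobj_category_def)
  ultimately show ?thesis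
    unfolding dobj_iso_def isomorphic_objects_def by blast
qed

end

theorem proposition3p3p7:
  fixes C :: "('o, 'm, 'd, 'e, 'z) sccwd_scheme"
    and \<Gamma> :: 'o and A B S S' :: 'd and w1 w2 w1' w2' :: 'e
  assumes "SCCwD C"
    and "\<Gamma> \<in> objs C"
    and "A \<in> dobj C \<Gamma>"
    and "B \<in> dobj C (ext C \<Gamma> A)"
    and "is_Sigma_space C \<Gamma> A B S w1 w2"
    and "is_Sigma_space C \<Gamma> A B S' w1' w2'"
  shows "dobj_iso C \<Gamma> S \<Gamma> S'"
  using assms by (rule SCCwD.Sigma_space_unique)

end
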